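(* Suppose $x,y\to\infty$ in such a way that $y=o(\log x)$. Then $$A(x,y)\sim \Psi(x,y),$$ i.e. $A(x,y)/\Psi(x,y)\to 1$.
   Context: For $x\ge 1$ and $y\ge 2$, let $S(x,y)=\{n\le x: P(n)\le y\}$ be the set of $y$-smooth positive integers up to $x$, where $P(n)$ is the largest prime factor of $n\ge 2$ and $P(1)=1$. Let $\Psi(x,y)=|S(x,y)|$. Define $$A(x,y)=\#\{ab:\ a,b\in S(\sqrt{x},y)\},$$ the number of distinct integers that can be written as a product of two $y$-smooth integers each at most $\sqrt{x}$. *)

theory Defs
  imports
    Complex_Main
    "HOL-Computational_Algebra.Primes"
    "HOL-Library.Landau_Symbols"
begin

definition largest_prime_factor :: "nat \<Rightarrow> nat" where
  "largest_prime_factor n = (if n = 1 then 1 else Max (prime_factors n))"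

definition smooth_upto :: "real \<Rightarrow> real \<Rightarrow> nat set" where
  "smooth_upto x y = {n. 1 \<le> n \<and> real n \<le> x \<and> real (largest_prime_factor n) \<le> y}"

definition smooth_count :: "real \<Rightarrow> real \<Rightarrow> nat" where
  "smooth_count x y = card (smooth_upto x y)"

definition smooth_product_count :: "real \<Rightarrow> real \<Rightarrow> nat" where
  "smooth_product_count x y =
     card {a * b | a b. a \<in> smooth_upto (sqrt x) y \<and> b \<in> smooth_upto (sqrt x) y}"

end

theory Submission
  imports Defs
begin

text \<open>If \<open>n \<le> x / y\<close> is \<open>y\<close>-smooth, then \<open>n\<close> is a product of two divisors up to \<open>sqrt x\<close>: any
  interval \<open>[t, t y]\<close> with \<open>1 \<le> t \<le> n\<close> contains a divisor of \<open>n\<close>. So it suffices that the set \<open>D\<close> of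
  smooth numbers in \<open>(x / y, x]\<close> is a negligible part of the smooth numbers up to \<open>x\<close>. Summing
  \<open>ln n = (\<Sum>q prime. multiplicity q n * ln q)\<close> over \<open>D\<close> and writing \<open>n = m * q ^ j\<close>, each pair
  \<open>(m, q)\<close> contributes at most \<open>ln y + ln q\<close>, whence
  \<open>card D * ln (x / y) \<le> 2 \<pi>(y) ln y \<Psi>(x, y)\<close>, and Chebyshev's bound \<open>\<pi>(y) ln y = O(y)\<close> finishes
  the proof.\<close>

section \<open>Chebyshev's upper bound for the number of primes\<close>

lemma finite_primes_upto: "finite {p::nat. prime p \<and> real p \<le> y}"
  by (rule finite_subset[of _ "{..nat \<lfloor>y\<rfloor>}"]) (auto simp: le_nat_floor)

lemma prod_primes_dvd:
  fixes c :: nat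
  assumes "finite A" "\<And>p. p \<in> A \<Longrightarrow> prime p" "\<And>p. p \<in> A \<Longrightarrow> p dvd c"
  shows "\<Prod>A dvd c"
  using assms
proof (induction A)
  case (insert a A)
  have "coprime a (\<Prod>A)"
    using insert by (intro prod_coprime_right primes_coprime) auto
  thus ?case using insert by (simp add: divides_mult)
qed auto

text \<open>Each such prime divides \<open>(2 * m + 1)!\<close> but neither \<open>m!\<close> nor
  \<open>(m + 1)!\<close>, so it survives in the binomial coefficient.\<close>

lemma primes_between_dvd_binomial:
  "\<Prod>{p. prime p \<and> m + 1 < p \<and> p \<le> 2 * m + 1} dvd ((2 * m + 1) choose m)"
proof -
  have "p dvd ((2 * m + 1) choose m)" if p: "prime p" "m + 1 < p" "p \<le> 2 * m + 1" for p
  proof -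
    have "p dvd fact (2 * m + 1)"
      using p by (subst prime_dvd_fact_iff) auto
    also have "fact (2 * m + 1) = fact m * fact (m + 1) * ((2 * m + 1) choose m)"
      using binomial_fact_lemma[of m "2 * m + 1"] by simp
    finally show ?thesis
      using p by (auto simp: prime_dvd_mult_iff prime_dvd_fact_iff simp del: fact_Suc)
  qed
  thus ?thesis by (intro prod_primes_dvd) auto
qed

text \<open>Erdos's strong induction: an even \<open>n > 2\<close> brings no new prime, and for
  \<open>n = 2 * m + 1\<close> the primes above \<open>m + 1\<close> have a product dividing a
  binomial coefficient that is at most \<open>4 ^ m\<close>.\<close>

lemma primorial_le: "\<Prod>{p::nat. prime p \<and> p \<le> n} \<le> 4 ^ n"
proof (induction n rule: less_induct)
  case (less n)
  consider "n < 2" | "n = 2" | "n > 2" "even n" | "n > 2" "odd n" by linarith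
  thus ?case
  proof cases
    case 1
    hence "\<not> (prime p \<and> p \<le> n)" for p using prime_ge_2_nat[of p] by linarith
    hence "{p::nat. prime p \<and> p \<le> n} = {}" by blast
    thus ?thesis by (metis one_le_numeral one_le_power prod.empty)
  next
    case 2
    have "prime p \<and> p \<le> n \<longleftrightarrow> p = 2" for p
      using 2 prime_ge_2_nat[of p] by auto
    hence "{p::nat. prime p \<and> p \<le> n} = {2}" by blast
    thus ?thesis using 2 by simp
  next
    case 3
    hence "\<not> prime n" using prime_odd_nat by blast
    hence ne: "p \<noteq> n" if "prime p" for p using that by blast
    have "p \<le> n \<longleftrightarrow> p \<le> n - 1" if "prime p" for p
      using ne[OF that] by linarith
    hence "{p::nat. prime p \<and> p \<le> n} = {p::nat. prime p \<and> p \<le> n - 1}" by blast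
    moreover have "\<Prod>{p::nat. prime p \<and> p \<le> n - 1} \<le> 4 ^ (n - 1)"
      using 3 by (intro less.IH) auto
    moreover have "(4::nat) ^ (n - 1) \<le> 4 ^ n" by (intro power_increasing) auto
    ultimately show ?thesis by (metis order_trans)
  next
    case 4
    then obtain m where m: "n = 2 * m + 1" by (auto elim: oddE)
    let ?A = "{p. prime p \<and> p \<le> m + 1}"
    let ?B = "{p. prime p \<and> m + 1 < p \<and> p \<le> 2 * m + 1}"
    have "{p::nat. prime p \<and> p \<le> n} = ?A \<union> ?B" using m by auto
    hence "\<Prod>{p::nat. prime p \<and> p \<le> n} = \<Prod>(?A \<union> ?B)" by (rule arg_cong)
    also have "\<dots> = \<Prod>?A * \<Prod>?B"
      by (intro prod.union_disjoint) auto
    also have "\<dots> \<le> 4 ^ (m + 1) * 4 ^ m"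
    proof (rule mult_le_mono)
      show "\<Prod>?A \<le> 4 ^ (m + 1)"
        using less.IH[of "m + 1"] 4 m by simp
      show "\<Prod>?B \<le> 4 ^ m"
      proof -
        \<comment> \<open>The two central entries of row \<open>2 * m + 1\<close> are equal, and the
          whole row sums to \<open>2 * 4 ^ m\<close>.\<close>
        have "2 * ((2 * m + 1) choose m) = (\<Sum>k\<in>{m, m + 1}. (2 * m + 1) choose k)"
          using binomial_symmetric[of m "2 * m + 1"] by simp
        also have "\<dots> \<le> (\<Sum>k\<le>2 * m + 1. (2 * m + 1) choose k)"
          by (intro sum_mono2) auto
        also have "\<dots> = 2 * 4 ^ m"
          unfolding choose_row_sum by (simp add: power_mult)
        finally have "((2 * m + 1) choose m) \<le> 4 ^ m" by simp
        moreover have "\<Prod>?B \<le> ((2 * m + 1) choose m)"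
          by (intro dvd_imp_le primes_between_dvd_binomial) simp
        ultimately show ?thesis by linarith
      qed
    qed
    also have "\<dots> = 4 ^ n" using m by (simp add: power_add mult_2)
    finally show ?thesis .
  qed
qed

text \<open>The primes are split at \<open>sqrt y\<close>: the small ones number at most
  \<open>sqrt y\<close>, while each large one has logarithm at least \<open>ln y / 2\<close>, so
  that the primorial bound limits their number. The two parts give \<open>2 * y\<close> and
  \<open>6 * y\<close>.\<close>

lemma card_primes_upto_le:
  assumes "y \<ge> 1"
  shows "real (card {p::nat. prime p \<and> real p \<le> y}) * ln y \<le> 8 * y"
proof -
  let ?A = "{p::nat. prime p \<and> real p \<le> sqrt y}"
  let ?B = "{p::nat. prime p \<and> sqrt y < real p \<and> real p \<le> y}"
  have fin: "finite ?B" "finite ?A"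
    using finite_primes_upto[of "sqrt y"] by (auto intro!: finite_subset[of ?B, OF _ finite_primes_upto[of y]])
  \<comment> \<open>The inequality \<open>ln t \<le> t - 1\<close> is used at
    \<open>t = sqrt y\<close>.\<close>
  have ln_y: "0 \<le> ln y" "ln y \<le> 2 * sqrt y"
    using assms ln_le_minus_one[of "sqrt y"] by (auto simp: ln_sqrt)
  have "?A \<subseteq> {1..nat \<lfloor>sqrt y\<rfloor>}"
    by (auto simp: le_nat_floor Suc_le_eq prime_gt_0_nat)
  from card_mono[OF _ this] have "real (card ?A) \<le> real (nat \<lfloor>sqrt y\<rfloor>)" by simp
  also have "\<dots> \<le> sqrt y" using assms by (intro of_nat_floor) simp
  finally have "real (card ?A) \<le> sqrt y" .
  hence "real (card ?A) * ln y \<le> sqrt y * (2 * sqrt y)"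
    using ln_y assms by (intro mult_mono) auto
  also have "sqrt y * (2 * sqrt y) = 2 * y" using assms by simp
  finally have A: "real (card ?A) * ln y \<le> 2 * y" .
  have "real (card ?B) * (ln y / 2) = (\<Sum>p\<in>?B. ln (sqrt y))"
    using assms by (simp add: ln_sqrt)
  also have "\<dots> \<le> (\<Sum>p\<in>?B. ln (real p))"
    using assms by (intro sum_mono ln_mono) (auto intro: prime_gt_0_nat)
  also have "\<dots> \<le> (\<Sum>p\<in>{p. prime p \<and> p \<le> nat \<lfloor>y\<rfloor>}. ln (real p))"
    by (intro sum_mono2) (auto simp: le_nat_floor dest: prime_gt_0_nat)
  also have "\<dots> = ln (real (\<Prod>{p. prime p \<and> p \<le> nat \<lfloor>y\<rfloor>}))"
    unfolding of_nat_prod by (intro ln_prod[symmetric]) (auto dest: prime_gt_0_nat)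
  also have "\<dots> \<le> ln (4 ^ nat \<lfloor>y\<rfloor>)"
  proof (intro ln_mono)
    show "real (\<Prod>{p. prime p \<and> p \<le> nat \<lfloor>y\<rfloor>}) \<le> 4 ^ nat \<lfloor>y\<rfloor>"
      using of_nat_mono[OF primorial_le[of "nat \<lfloor>y\<rfloor>"], where 'a = real] by simp
    show "0 < real (\<Prod>{p. prime p \<and> p \<le> nat \<lfloor>y\<rfloor>})"
      unfolding of_nat_0_less_iff by (intro prod_pos) (auto dest: prime_gt_0_nat)
  qed
  also have "\<dots> = real (nat \<lfloor>y\<rfloor>) * ln 4" by (simp add: ln_realpow)
  \<comment> \<open>The factor 3 comes from \<open>ln 4 \<le> 4 - 1\<close>.\<close>
  also have "\<dots> \<le> y * 3"
    using assms ln_le_minus_one[of 4] by (intro mult_mono) auto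
  finally have "real (card ?B) * ln y \<le> 6 * y" by simp
  moreover have "sqrt y \<le> y" using assms real_sqrt_le_iff[of y "y\<^sup>2"]
    by (simp add: power2_eq_square)
  hence "{p::nat. prime p \<and> real p \<le> y} = ?A \<union> ?B" by auto
  hence "real (card {p::nat. prime p \<and> real p \<le> y}) = real (card ?A) + real (card ?B)"
    using fin by (simp, subst card_Un_disjoint) auto
  ultimately show ?thesis using A by (simp add: algebra_simps)
qed

section \<open>Smooth numbers and their factorisations\<close>

text \<open>Trades the maximum of the prime factors for a condition that passes easily to products
  and divisors. The hypothesis \<open>y \<ge> 1\<close> covers \<open>n = 1\<close>, whose largest
  prime factor is 1 by convention.\<close>

lemma smooth_upto_iff:
  assumes "y \<ge> 1"
  shows "n \<in> smooth_upto x y \<longleftrightarrow>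
    1 \<le> n \<and> real n \<le> x \<and> (\<forall>p. prime p \<longrightarrow> p dvd n \<longrightarrow> real p \<le> y)"
proof (cases "n \<le> 1")
  case True
  thus ?thesis using assms
    by (cases n) (auto simp: smooth_upto_def largest_prime_factor_def)
next
  case False
  hence "prime_factors n \<noteq> {}" by (auto simp: prime_factorization_empty_iff)
  hence "real (Max (prime_factors n)) \<le> y \<longleftrightarrow> (\<forall>p\<in>prime_factors n. real p \<le> y)"
    by (metis (mono_tags, lifting) Max_ge Max_in finite_set_mset of_nat_mono order_trans)
  thus ?thesis using False
    by (auto simp: smooth_upto_def largest_prime_factor_def in_prime_factors_iff)
qed

lemma finite_smooth_upto: "finite (smooth_upto x y)"
  by (rule finite_subset[of _ "{..nat \<lfloor>x\<rfloor>}"]) (auto simp: smooth_upto_def le_nat_floor)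

lemma smooth_upto_mult:
  assumes "y \<ge> 1" "a \<in> smooth_upto u y" "b \<in> smooth_upto v y"
  shows "a * b \<in> smooth_upto (u * v) y"
  using assms by (auto simp: smooth_upto_iff prime_dvd_mult_iff intro: mult_mono)

lemma smooth_upto_dvd:
  assumes "y \<ge> 1" "n \<in> smooth_upto x y" "d dvd n" "real d \<le> z"
  shows "d \<in> smooth_upto z y"
  using assms dvd_trans[of _ d n] dvd_pos_nat[of n d] by (auto simp: smooth_upto_iff Suc_le_eq)

text \<open>Unless it is \<open>n\<close> itself, the largest divisor of \<open>n\<close> not exceeding \<open>sqrt x\<close> is
  larger than \<open>sqrt x / y\<close>, because multiplying it by one more prime overshoots.\<close>

lemma smooth_upto_factorisation:
  assumes "y \<ge> 1" "x \<ge> 1" "n \<in> smooth_upto (x / y) y"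
  obtains a b where "a \<in> smooth_upto (sqrt x) y" "b \<in> smooth_upto (sqrt x) y" "n = a * b"
proof -
  let ?D = "{d. d dvd n \<and> real d \<le> sqrt x}"
  have n: "n > 0" "real n \<le> x / y" "\<And>p. prime p \<Longrightarrow> p dvd n \<Longrightarrow> real p \<le> y"
    using assms by (auto simp: smooth_upto_iff)
  have D: "finite ?D" "1 \<in> ?D" using n assms by auto
  define a where "a = Max ?D"
  have a: "a dvd n" "real a \<le> sqrt x" and a_max: "\<And>d. d \<in> ?D \<Longrightarrow> d \<le> a"
    using Max_in[of ?D] Max_ge[of ?D] D unfolding a_def by blast+
  then obtain b where b: "n = a * b" by auto
  have pos: "a > 0" "b > 0" using n b by auto
  have "real b \<le> sqrt x"
  proof (cases "b = 1")
    case False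
    then obtain p where p: "prime p" "p dvd b" using prime_factor_nat by blast
    have "a * p dvd n" using p b by simp
    moreover have "a * p > a" using p pos prime_gt_1_nat by simp
    ultimately have "real (a * p) > sqrt x" using a_max[of "a * p"] by force
    moreover have "real p \<le> y" using n p b by simp
    ultimately have "sqrt x < real a * y"
      using mult_left_mono[of "real p" y "real a"] by simp
    hence "sqrt x * real b \<le> real a * y * real b" by (intro mult_right_mono) auto
    also have "\<dots> = real n * y" using b by simp
    also have "\<dots> \<le> sqrt x * sqrt x" using n assms by (simp add: field_simps)
    finally show ?thesis using assms by (subst (asm) mult_le_cancel_left_pos) auto
  qed (use assms in auto)
  thus ?thesis using that[of a b] smooth_upto_dvd[OF assms(1,3)] a b by simp
qed

text \<open>The sandwich behind the limit: the lower bound is the factorisation above, the upper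
  bound is closure of smoothness under products.\<close>

lemma smooth_count_le_product_count:
  assumes "y \<ge> 1" "x \<ge> 1"
  shows "smooth_count (x / y) y \<le> smooth_product_count x y"
    and "smooth_product_count x y \<le> smooth_count x y"
proof -
  let ?P = "{a * b | a b. a \<in> smooth_upto (sqrt x) y \<and> b \<in> smooth_upto (sqrt x) y}"
  have sub: "?P \<subseteq> smooth_upto x y"
    using smooth_upto_mult[of y _ "sqrt x" _ "sqrt x"] assms by auto
  thus "smooth_product_count x y \<le> smooth_count x y"
    unfolding smooth_count_def smooth_product_count_def
    by (intro card_mono finite_smooth_upto)
  have "smooth_upto (x / y) y \<subseteq> ?P"
    using smooth_upto_factorisation[OF assms] by blast
  thus "smooth_count (x / y) y \<le> smooth_product_count x y"
    unfolding smooth_count_def smooth_product_count_def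
    by (intro card_mono finite_subset[OF sub finite_smooth_upto])
qed

section \<open>Counting the smooth numbers between \<open>x / y\<close> and \<open>x\<close>\<close>

text \<open>The index set \<open>A\<close> may exceed the prime factors of \<open>n\<close>, so that
  one set serves all \<open>n\<close> and the sums over \<open>n\<close> and over primes can later
  be swapped.\<close>

lemma ln_eq_sum_multiplicity:
  assumes "finite A" "prime_factors n \<subseteq> A" "n > 0" "\<And>p. p \<in> A \<Longrightarrow> prime p"
  shows "ln (real n) = (\<Sum>p\<in>A. real (multiplicity p n) * ln (real p))"
proof -
  have "ln (real n) = ln (\<Prod>p\<in>prime_factors n. real p ^ multiplicity p n)"
    using arg_cong[OF prime_factorization_nat[OF assms(3)], of "\<lambda>k. ln (real k)"]
    unfolding of_nat_prod of_nat_power .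
  also have "\<dots> = (\<Sum>p\<in>prime_factors n. ln (real p ^ multiplicity p n))"
    by (intro ln_prod) (auto dest: in_prime_factors_imp_prime prime_gt_0_nat)
  also have "\<dots> = (\<Sum>p\<in>prime_factors n. real (multiplicity p n) * ln (real p))"
    by (intro sum.cong refl ln_realpow)
  also have "\<dots> = (\<Sum>p\<in>A. real (multiplicity p n) * ln (real p))"
    using assms by (intro sum.mono_neutral_left) (auto simp: prime_factors_multiplicity)
  finally show ?thesis .
qed

text \<open>After taking logarithms, the exponents lie in an interval of length
  \<open>ln v / ln q\<close>, which holds at most \<open>ln v / ln q + 1\<close> integers.\<close>

lemma card_powers_between_le:
  assumes "q > 1" "u > 0" "v \<ge> (1::real)"
  shows "finite {j::nat. u < q ^ j \<and> q ^ j \<le> u * v}"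
    and "real (card {j::nat. u < q ^ j \<and> q ^ j \<le> u * v}) * ln q \<le> ln v + ln q"
proof -
  let ?J = "{j::nat. u < q ^ j \<and> q ^ j \<le> u * v}"
  have lq: "ln q > 0" using assms by simp
  have J: "ln u < real j * ln q" "real j * ln q \<le> ln u + ln v" if "j \<in> ?J" for j
  proof -
    from that have j: "u < q ^ j" "q ^ j \<le> u * v" by auto
    have "ln u < ln (q ^ j)" using j assms by simp
    moreover have "ln (q ^ j) \<le> ln (u * v)" using j assms by (intro ln_mono) auto
    ultimately show "ln u < real j * ln q" "real j * ln q \<le> ln u + ln v"
      using assms by (auto simp: ln_realpow ln_mult)
  qed
  show fin: "finite ?J"
    using J(2) lq by (intro finite_subset[of ?J "{..nat \<lfloor>(ln u + ln v) / ln q\<rfloor>}"])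
      (auto simp: le_nat_floor pos_le_divide_eq)
  show "real (card ?J) * ln q \<le> ln v + ln q"
  proof (cases "?J = {}")
    case True
    show ?thesis unfolding True using assms by simp
  next
    case False
    have mn: "Min ?J \<in> ?J" "Max ?J \<in> ?J"
      using Min_in[OF fin False] Max_in[OF fin False] by blast+
    have "?J \<subseteq> {Min ?J..Max ?J}" using fin by auto
    from card_mono[OF _ this] have "card ?J \<le> Suc (Max ?J) - Min ?J" by simp
    moreover have "Min ?J \<le> Max ?J" using fin mn by (intro Min_le)
    ultimately have "real (card ?J) \<le> real (Max ?J) - real (Min ?J) + 1" by linarith
    hence "real (card ?J) * ln q \<le> (real (Max ?J) - real (Min ?J) + 1) * ln q"
      using lq by (intro mult_right_mono) auto
    also have "\<dots> \<le> ln v + ln q"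
      using J(1)[OF mn(1)] J(2)[OF mn(2)] by (simp add: algebra_simps)
    finally show ?thesis .
  qed
qed

text \<open>Writing \<open>n = m * q ^ j\<close> for each \<open>1 \<le> j \<le> multiplicity q n\<close> and counting by \<open>m\<close>:
  a given \<open>m\<close> admits at most \<open>ln y / ln q + 1\<close> exponents \<open>j\<close> with
  \<open>x / y < m * q ^ j \<le> x\<close>.\<close>

lemma sum_multiplicity_smooth_le:
  assumes "y \<ge> 1" "x \<ge> 1" "prime q" "real q \<le> y"
  shows "(\<Sum>n\<in>smooth_upto x y - smooth_upto (x / y) y. real (multiplicity q n)) * ln (real q)
    \<le> 2 * ln y * real (smooth_count x y)"
proof -
  let ?S = "smooth_upto x y"
  let ?D = "?S - smooth_upto (x / y) y"
  \<comment> \<open>These are the \<open>j\<close> with \<open>x / y < m * q ^ j \<le> x\<close>,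
    put in the form of \<open>card_powers_between_le\<close> with \<open>u = x / y / m\<close> and
    \<open>v = y\<close>.\<close>
  define J where "J m = {j. x / y / real m < real q ^ j \<and> real q ^ j \<le> x / y / real m * y}" for m
  have q: "real q > 1" using assms(3) prime_gt_1_nat by auto
  have J: "finite (J m)" "real (card (J m)) * ln (real q) \<le> 2 * ln y" if "m \<in> ?S" for m
  proof -
    have "m > 0" using that assms by (auto simp: smooth_upto_iff)
    hence "x / y / real m > 0" using assms by simp
    note * = card_powers_between_le[OF q this assms(1)]
    show "finite (J m)" using * by (simp add: J_def)
    have "ln (real q) \<le> ln y" using q assms by (intro ln_mono) auto
    thus "real (card (J m)) * ln (real q) \<le> 2 * ln y" using * by (simp add: J_def)
  qed
  have D: "n > 0" "x / y < real n" "real n \<le> x" "n \<in> ?S" if "n \<in> ?D" for n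
    using that assms by (auto simp: smooth_upto_iff)
  have "(\<Sum>n\<in>?D. multiplicity q n) = card (SIGMA n:?D. {1..multiplicity q n})"
    using finite_smooth_upto by (subst card_SigmaI) auto
  also have "\<dots> \<le> card (SIGMA m:?S. J m)"
  proof (rule card_inj_on_le)
    \<comment> \<open>Since \<open>q ^ j\<close> divides \<open>n\<close>, the pair
      \<open>(n div q ^ j, j)\<close> determines \<open>n\<close>.\<close>
    show "inj_on (\<lambda>(n, j). (n div q ^ j, j)) (SIGMA n:?D. {1..multiplicity q n})"
      by (auto simp: inj_on_def) (metis dvd_div_mult_self multiplicity_dvd')
    show "(\<lambda>(n, j). (n div q ^ j, j)) ` (SIGMA n:?D. {1..multiplicity q n}) \<subseteq> (SIGMA m:?S. J m)"
    proof clarify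
      fix n j assume n: "n \<in> ?S" "n \<notin> smooth_upto (x / y) y" and j: "j \<in> {1..multiplicity q n}"
      from n have "n \<in> ?D" by simp
      note D = D[OF this]
      have "q ^ j dvd n" using j multiplicity_dvd' by auto
      then obtain m where m: "n = m * q ^ j" by (metis dvd_div_mult_self)
      have [simp]: "n div q ^ j = m" using m q by auto
      have "m > 0" using m D by auto
      have "m dvd n" using m by simp
      moreover from this have "real m \<le> x"
        using D dvd_imp_le[of m n] by (meson of_nat_mono order_trans)
      ultimately have "m \<in> ?S" using assms by (intro smooth_upto_dvd[OF _ D(4)])
      moreover have "j \<in> J m"
        using D m \<open>m > 0\<close> assms by (auto simp: J_def field_simps)
      ultimately show "n div q ^ j \<in> ?S \<and> j \<in> J (n div q ^ j)" by simp
    qed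
    show "finite (SIGMA m:?S. J m)" using J finite_smooth_upto by auto
  qed
  also have "\<dots> = (\<Sum>m\<in>?S. card (J m))"
    using J finite_smooth_upto by (subst card_SigmaI) auto
  finally have "(\<Sum>n\<in>?D. real (multiplicity q n)) \<le> (\<Sum>m\<in>?S. real (card (J m)))"
    by (metis of_nat_le_iff of_nat_sum)
  hence "(\<Sum>n\<in>?D. real (multiplicity q n)) * ln (real q) \<le> (\<Sum>m\<in>?S. real (card (J m))) * ln (real q)"
    using q by (intro mult_right_mono) auto
  also have "\<dots> \<le> (\<Sum>m\<in>?S. 2 * ln y)"
    unfolding sum_distrib_right by (intro sum_mono J)
  also have "\<dots> = 2 * ln y * real (smooth_count x y)" by (simp add: smooth_count_def)
  finally show ?thesis .
qed

text \<open>Every \<open>n\<close> in the difference set has \<open>ln n \<ge> ln (x / y)\<close>.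
  Expanding \<open>ln n\<close> over primes and swapping sums leaves at most \<open>2 * ln y\<close>
  times the smooth count per prime; with the constant 8 of the Chebyshev bound this gives
  16.\<close>

lemma smooth_count_diff_le:
  assumes "y \<ge> 1" "x \<ge> 1"
  shows "(real (smooth_count x y) - real (smooth_count (x / y) y)) * (ln x - ln y)
    \<le> 16 * y * real (smooth_count x y)"
proof -
  let ?S = "smooth_upto x y"
  let ?D = "?S - smooth_upto (x / y) y"
  let ?P = "{p::nat. prime p \<and> real p \<le> y}"
  have "x / y \<le> x" using assms by (simp add: field_simps)
  hence "smooth_upto (x / y) y \<subseteq> ?S" by (auto simp: smooth_upto_def)
  hence "card ?D = smooth_count x y - smooth_count (x / y) y"
    and "smooth_count (x / y) y \<le> smooth_count x y"
    unfolding smooth_count_def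
    by (auto intro: card_Diff_subset finite_smooth_upto card_mono)
  hence "(real (smooth_count x y) - real (smooth_count (x / y) y)) * (ln x - ln y)
      = (\<Sum>n\<in>?D. ln (x / y))"
    using assms by (simp add: ln_div)
  also have "\<dots> \<le> (\<Sum>n\<in>?D. ln (real n))"
    using assms by (intro sum_mono ln_mono) (auto simp: smooth_upto_iff)
  also have "\<dots> = (\<Sum>n\<in>?D. \<Sum>q\<in>?P. real (multiplicity q n) * ln (real q))"
    using assms by (intro sum.cong refl ln_eq_sum_multiplicity finite_primes_upto)
      (auto simp: smooth_upto_iff in_prime_factors_iff)
  also have "\<dots> = (\<Sum>q\<in>?P. (\<Sum>n\<in>?D. real (multiplicity q n)) * ln (real q))"
    by (subst sum.swap) (simp add: sum_distrib_right)
  also have "\<dots> \<le> (\<Sum>q\<in>?P. 2 * ln y * real (smooth_count x y))"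
    using assms by (intro sum_mono sum_multiplicity_smooth_le) auto
  also have "\<dots> = 2 * (real (card ?P) * ln y) * real (smooth_count x y)" by simp
  also have "\<dots> \<le> 2 * (8 * y) * real (smooth_count x y)"
    using card_primes_upto_le[OF assms(1)] by (intro mult_right_mono mult_left_mono) auto
  finally show ?thesis by simp
qed

section \<open>Passage to the limit by squeezing the ratio\<close>

theorem theorem1p1:
  fixes x y :: "'a \<Rightarrow> real" and F :: "'a filter"
  assumes "filterlim x at_top F"
    and "filterlim y at_top F"
    and "y \<in> o[F](\<lambda>i. ln (x i))"
  shows "((\<lambda>i. real (smooth_product_count (x i) (y i)) / real (smooth_count (x i) (y i)))
           \<longlongrightarrow> 1) F"
proof (rule tendsto_sandwich)
  have x: "\<forall>\<^sub>F i in F. x i > 1"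
    using assms(1) by (simp add: filterlim_at_top_dense)
  have y: "\<forall>\<^sub>F i in F. y i \<ge> 1"
    using assms(2) by (simp add: filterlim_at_top)
  \<comment> \<open>With \<open>ln y \<le> y\<close>, the constant 1/2 ensures
    \<open>ln x - ln y \<ge> ln x / 2\<close>.\<close>
  have y_le: "\<forall>\<^sub>F i in F. norm (y i) \<le> 1 / 2 * norm (ln (x i))"
    using landau_o.smallD[OF assms(3), of "1 / 2"] by simp
  have "((\<lambda>i. y i / ln (x i)) \<longlongrightarrow> 0) F"
    by (rule smalloD_tendsto[OF assms(3)])
  \<comment> \<open>The constant is 16 from \<open>smooth_count_diff_le\<close>, doubled by
    replacing \<open>ln x - ln y\<close> with \<open>ln x / 2\<close>.\<close>
  thus "((\<lambda>i. 1 - 32 * (y i / ln (x i))) \<longlongrightarrow> 1) F"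
    using tendsto_diff[OF tendsto_const[of 1] tendsto_mult[OF tendsto_const[of 32]]] by force
  show "\<forall>\<^sub>F i in F. 1 - 32 * (y i / ln (x i))
      \<le> real (smooth_product_count (x i) (y i)) / real (smooth_count (x i) (y i))"
    using x y y_le
  proof eventually_elim
    case (elim i)
    let ?N = "real (smooth_count (x i) (y i))" and ?M = "real (smooth_count (x i / y i) (y i))"
    \<comment> \<open>The element 1 makes the denominator of the ratio positive.\<close>
    have "1 \<in> smooth_upto (x i) (y i)" using elim by (simp add: smooth_upto_iff)
    hence N: "?N > 0" using finite_smooth_upto by (auto simp: smooth_count_def card_gt_0_iff)
    have lx: "ln (x i) > 0" using elim by simp
    have MN: "?M \<le> ?N"
      using smooth_count_le_product_count[of "y i" "x i"] elim by simp
    have "ln (y i) \<le> y i" using elim ln_le_minus_one[of "y i"] by simp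
    hence "ln (x i) / 2 \<le> ln (x i) - ln (y i)" using elim lx by simp
    hence "(?N - ?M) * (ln (x i) / 2) \<le> (?N - ?M) * (ln (x i) - ln (y i))"
      using MN by (intro mult_left_mono) auto
    also have "\<dots> \<le> 16 * y i * ?N" using smooth_count_diff_le elim by simp
    finally have "1 - 32 * (y i / ln (x i)) \<le> ?M / ?N"
      using N lx by (simp add: field_simps)
    also have "\<dots> \<le> real (smooth_product_count (x i) (y i)) / ?N"
      using smooth_count_le_product_count[of "y i" "x i"] elim by (intro divide_right_mono) auto
    finally show ?case .
  qed
  show "\<forall>\<^sub>F i in F. real (smooth_product_count (x i) (y i)) / real (smooth_count (x i) (y i)) \<le> 1"
    using x y
  proof eventually_elim
    case (elim i)
    thus ?case
      using smooth_count_le_product_count(2)[of "y i" "x i"] by (simp add: divide_le_eq_1_pos divide_le_eq)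
  qed
qed simp

end
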